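(* Let $\Phi=(G,\varphi)$ be a $\mathbb{T}$-gain graph on a connected simple graph $G$ with vertex set $\{v_1,\dots,v_n\}$, and let $<$ be a total order on $V(G)$. Then: (1) $\mathrm{nullity}(\mathcal{DL}^{\max}_{<}(\Phi))=1$ if and only if $\Phi$ is balanced; (2) $\mathrm{nullity}(\mathcal{DL}^{\max}_{<}(\Phi))=0$ if and only if $\Phi$ is unbalanced.
   Context: $\mathbb{T}=\{z\in\mathbb{C}:|z|=1\}$. A $\mathbb{T}$-gain graph $\Phi=(G,\varphi)$ assigns to each of the two orientations $\vec e_{i,j},\vec e_{j,i}$ of every edge $v_iv_j$ of $G$ a gain in $\mathbb{T}$ with $\varphi(\vec e_{j,i})=\overline{\varphi(\vec e_{i,j})}$. The gain of an oriented path or cycle is the product of the gains of its consecutive oriented edges; $\Phi$ is balanced if every cycle has gain $1$. $d(u,v)$ is the shortest-path distance in $G$. For vertices $s<t$, $\varphi^{<}_{\max}(s,t)$ is the maximum of the gains of all shortest oriented paths from $s$ to $t$, with respect to the lexicographic order on $\mathbb{C}$ ($a+ib\le c+id$ iff $a<c$, or $a=c$ and $b\le d$); $\varphi^{<}_{\max}(t,s)=\overline{\varphi^{<}_{\max}(s,t)}$ and $\varphi^{<}_{\max}(s,s)=0$. $\mathcal{D}^{\max}_{<}(\Phi)=(\varphi^{<}_{\max}(v_i,v_j)d(v_i,v_j))_{i,j}$, $\mathrm{Tr}(G)=\mathrm{diag}(\mathrm{Tr}(v_1),\dots,\mathrm{Tr}(v_n))$ with $\mathrm{Tr}(v_i)=\sum_j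 d(v_i,v_j)$, and $\mathcal{DL}^{\max}_{<}(\Phi)=\mathrm{Tr}(G)-\mathcal{D}^{\max}_{<}(\Phi)$. The nullity of a matrix is the dimension of its null space. *)

theory Defs
  imports "HOL-Analysis.Analysis"
begin

text \<open>
  The vertex set is a finite type, so the number of vertices is an arbitrary \<open>n \<ge> 1\<close>;
  a graph is given by its adjacency relation. Paths and cycles are lists of distinct vertices;
  in a cycle the closing edge from the last to the first vertex is implicit.
\<close>

definition simple_graph :: "('v \<Rightarrow> 'v \<Rightarrow> bool) \<Rightarrow> bool" where
  "simple_graph E \<longleftrightarrow> symp E \<and> irreflp E"

definition is_path :: "('v \<Rightarrow> 'v \<Rightarrow> bool) \<Rightarrow> 'v \<Rightarrow> 'v list \<Rightarrow> 'v \<Rightarrow> bool" where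
  "is_path E u p v \<longleftrightarrow> p \<noteq> [] \<and> hd p = u \<and> last p = v \<and> distinct p \<and> successively E p"

definition is_cycle :: "('v \<Rightarrow> 'v \<Rightarrow> bool) \<Rightarrow> 'v list \<Rightarrow> bool" where
  "is_cycle E p \<longleftrightarrow> 3 \<le> length p \<and> distinct p \<and> successively E p \<and> E (last p) (hd p)"

definition connected_graph :: "('v \<Rightarrow> 'v \<Rightarrow> bool) \<Rightarrow> bool" where
  "connected_graph E \<longleftrightarrow> (\<forall>u v. \<exists>p. is_path E u p v)"

text \<open>A path with vertex list \<open>p\<close> has \<open>length p - 1\<close> edges.\<close>

definition gdist :: "('v \<Rightarrow> 'v \<Rightarrow> bool) \<Rightarrow> 'v \<Rightarrow> 'v \<Rightarrow> nat" where
  "gdist E u v = (LEAST k. \<exists>p. is_path E u p v \<and> length p - 1 = k)"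

definition is_shortest_path :: "('v \<Rightarrow> 'v \<Rightarrow> bool) \<Rightarrow> 'v \<Rightarrow> 'v list \<Rightarrow> 'v \<Rightarrow> bool" where
  "is_shortest_path E u p v \<longleftrightarrow> is_path E u p v \<and> length p - 1 = gdist E u v"

text \<open>\<open>\<phi> u v\<close> is the gain of the edge oriented from \<open>u\<close> to \<open>v\<close>; its values at non-adjacent
  pairs are irrelevant.\<close>

definition gain_function :: "('v \<Rightarrow> 'v \<Rightarrow> bool) \<Rightarrow> ('v \<Rightarrow> 'v \<Rightarrow> complex) \<Rightarrow> bool" where
  "gain_function E \<phi> \<longleftrightarrow> (\<forall>u v. E u v \<longrightarrow> \<phi> u v \<in> sphere 0 1 \<and> \<phi> v u = cnj (\<phi> u v))"

fun path_gain :: "('v \<Rightarrow> 'v \<Rightarrow> complex) \<Rightarrow> 'v list \<Rightarrow> complex" where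
  "path_gain \<phi> (u # v # p) = \<phi> u v * path_gain \<phi> (v # p)"
| "path_gain \<phi> p = 1"

definition cycle_gain :: "('v \<Rightarrow> 'v \<Rightarrow> complex) \<Rightarrow> 'v list \<Rightarrow> complex" where
  "cycle_gain \<phi> p = path_gain \<phi> (p @ [hd p])"

definition balanced :: "('v \<Rightarrow> 'v \<Rightarrow> bool) \<Rightarrow> ('v \<Rightarrow> 'v \<Rightarrow> complex) \<Rightarrow> bool" where
  "balanced E \<phi> \<longleftrightarrow> (\<forall>p. is_cycle E p \<longrightarrow> cycle_gain \<phi> p = 1)"

definition lex_le :: "complex \<Rightarrow> complex \<Rightarrow> bool" where
  "lex_le z w \<longleftrightarrow> Re z < Re w \<or> (Re z = Re w \<and> Im z \<le> Im w)"

definition lex_Max :: "complex set \<Rightarrow> complex" where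
  "lex_Max S = (THE z. z \<in> S \<and> (\<forall>w\<in>S. lex_le w z))"

lemma lex_Max_greatest:
  assumes "finite S" "S \<noteq> {}"
  shows "lex_Max S \<in> S \<and> (\<forall>w\<in>S. lex_le w (lex_Max S))"
proof -
  have ex: "\<exists>z. z \<in> S \<and> (\<forall>w\<in>S. lex_le w z)"
    using assms
  proof (induction S rule: finite_ne_induct)
    case (singleton x)
    then show ?case by (simp add: lex_le_def)
  next
    case (insert x F)
    then obtain z where z: "z \<in> F" "\<forall>w\<in>F. lex_le w z" by blast
    show ?case
    proof (cases "lex_le x z")
      case True
      with z show ?thesis by blast
    next
      case False
      with z have "\<forall>w\<in>insert x F. lex_le w x"
        by (fastforce simp: lex_le_def)
      then show ?thesis by blast
    qed
  qed
  have "z = z'" if "lex_le z z'" "lex_le z' z" for z z'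
    using that by (auto simp: lex_le_def complex_eq_iff)
  with ex have "\<exists>!z. z \<in> S \<and> (\<forall>w\<in>S. lex_le w z)" by blast
  then show ?thesis unfolding lex_Max_def by (rule theI')
qed

text \<open>\<open>(s, t) \<in> r\<close> means that \<open>s\<close> strictly precedes \<open>t\<close> in the order on the vertices.\<close>

definition gain_max ::
  "('v \<Rightarrow> 'v \<Rightarrow> bool) \<Rightarrow> ('v \<Rightarrow> 'v \<Rightarrow> complex) \<Rightarrow> 'v rel \<Rightarrow> 'v \<Rightarrow> 'v \<Rightarrow> complex" where
  "gain_max E \<phi> r s t =
    (if s = t then 0
     else if (s, t) \<in> r then lex_Max {path_gain \<phi> p | p. is_shortest_path E s p t}
     else cnj (lex_Max {path_gain \<phi> p | p. is_shortest_path E t p s}))"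

definition dist_matrix_max ::
  "('v::finite \<Rightarrow> 'v \<Rightarrow> bool) \<Rightarrow> ('v \<Rightarrow> 'v \<Rightarrow> complex) \<Rightarrow> 'v rel \<Rightarrow> complex^'v^'v" where
  "dist_matrix_max E \<phi> r = (\<chi> i j. gain_max E \<phi> r i j * of_nat (gdist E i j))"

definition transmission :: "('v::finite \<Rightarrow> 'v \<Rightarrow> bool) \<Rightarrow> 'v \<Rightarrow> nat" where
  "transmission E v = (\<Sum>w\<in>UNIV. gdist E v w)"

definition transmission_matrix :: "('v::finite \<Rightarrow> 'v \<Rightarrow> bool) \<Rightarrow> complex^'v^'v" where
  "transmission_matrix E = (\<chi> i j. if i = j then of_nat (transmission E i) else 0)"

definition dist_laplacian_max ::
  "('v::finite \<Rightarrow> 'v \<Rightarrow> bool) \<Rightarrow> ('v \<Rightarrow> 'v \<Rightarrow> complex) \<Rightarrow> 'v rel \<Rightarrow> complex^'v^'v" where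
  "dist_laplacian_max E \<phi> r = transmission_matrix E - dist_matrix_max E \<phi> r"

definition nullity :: "complex^'n^'m \<Rightarrow> nat" where
  "nullity A = vec.dim {x. A *v x = 0}"

end

theory Submission
  imports Defs
begin

text \<open>
  Since the maximal gains \<open>g(i,j)\<close> are unimodular and \<open>d\<close> is symmetric, twice the real part of \<open>x\<^sup>* L x\<close> is
  \<open>\<Sum>\<^sub>i\<^sub>j d(i,j) |x\<^sub>i - g(i,j) x\<^sub>j|\<^sup>2\<close>, so the kernel of the distance Laplacian consists of the
  \<open>x\<close> with \<open>x\<^sub>i = g(i,j) x\<^sub>j\<close> for all \<open>i \<noteq> j\<close>. On an edge the maximal gain is the gain of that
  edge, hence a kernel vector is a potential: \<open>x\<^sub>i = \<phi>(i,j) x\<^sub>j\<close> on all edges. On a connected graph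
  a potential is determined up to a scalar, and a nonzero one forces all cycle gains to be \<open>1\<close>.
  Conversely, in a balanced graph all walks between two given vertices have equal gain, and the
  gains of the walks to a fixed root form a potential that lies in the kernel.
\<close>

text \<open>Unlike in \<open>is_path\<close>, vertices may repeat, so concatenated and closed walks
  are walks again.\<close>

definition is_walk :: "('v \<Rightarrow> 'v \<Rightarrow> bool) \<Rightarrow> 'v \<Rightarrow> 'v list \<Rightarrow> 'v \<Rightarrow> bool" where
  "is_walk E u p v \<longleftrightarrow> p \<noteq> [] \<and> hd p = u \<and> last p = v \<and> successively E p"

lemma is_path_imp_is_walk: "is_path E u p v \<Longrightarrow> is_walk E u p v"
  by (simp add: is_path_def is_walk_def)

lemma path_gain_append:
  "path_gain \<phi> (a @ x # b) = path_gain \<phi> (a @ [x]) * path_gain \<phi> (x # b)"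
proof (induction a)
  case (Cons y a)
  then show ?case by (cases a) auto
qed simp

lemma is_walk_append:
  "is_walk E u (a @ x # b) v \<longleftrightarrow> is_walk E u (a @ [x]) x \<and> is_walk E x (x # b) v"
  by (auto simp: is_walk_def successively_append_iff hd_append)

locale gain_graph =
  fixes E :: "'v::finite \<Rightarrow> 'v \<Rightarrow> bool"
    and \<phi> :: "'v \<Rightarrow> 'v \<Rightarrow> complex"
  assumes simple: "simple_graph E"
    and connected: "connected_graph E"
    and gain: "gain_function E \<phi>"
begin

lemma edge_sym: "E u v \<Longrightarrow> E v u"
  using simple by (auto simp: simple_graph_def dest: sympD)

lemma edge_irrefl: "\<not> E u u"
  using simple by (auto simp: simple_graph_def dest: irreflpD)

lemma norm_edge_gain: "E u v \<Longrightarrow> norm (\<phi> u v) = 1"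
  using gain by (auto simp: gain_function_def)

lemma edge_gain_flip: "E u v \<Longrightarrow> \<phi> v u = cnj (\<phi> u v)"
  using gain by (auto simp: gain_function_def)

lemma edge_gain_mult_flip: "E u v \<Longrightarrow> \<phi> u v * \<phi> v u = 1"
  by (simp add: edge_gain_flip norm_edge_gain flip: complex_norm_square)

lemma norm_path_gain: "successively E p \<Longrightarrow> norm (path_gain \<phi> p) = 1"
  by (induction p rule: induct_list012) (auto simp: norm_mult norm_edge_gain)

lemma successively_edge_rev: "successively E (rev p) \<longleftrightarrow> successively E p"
  unfolding successively_rev using edge_sym by (blast intro: successively_mono)

lemma is_walk_rev: "is_walk E u p v \<Longrightarrow> is_walk E v (rev p) u"
  by (simp add: is_walk_def successively_edge_rev hd_rev last_rev del: successively_rev)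

lemma is_path_rev: "is_path E u p v \<Longrightarrow> is_path E v (rev p) u"
  by (simp add: is_path_def successively_edge_rev hd_rev last_rev del: successively_rev)

text \<open>Reversal takes each edge in its opposite orientation, which conjugates every
  factor.\<close>

lemma path_gain_rev: "successively E p \<Longrightarrow> path_gain \<phi> (rev p) = cnj (path_gain \<phi> p)"
proof (induction p rule: induct_list012)
  case (3 x y zs)
  then have "path_gain \<phi> (rev (x # y # zs)) = cnj (path_gain \<phi> (y # zs)) * \<phi> y x"
    using path_gain_append[of \<phi> "rev zs" y "[x]"] by simp
  with 3 show ?case by (simp add: edge_gain_flip mult.commute)
qed auto

section \<open>Distances and shortest paths\<close>

lemma gdist_commute: "gdist E u v = gdist E v u"
proof -
  have "(\<exists>p. is_path E u p v \<and> length p - 1 = k) \<longleftrightarrow> (\<exists>p. is_path E v p u \<and> length p - 1 = k)" for k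
    by (metis is_path_rev length_rev)
  then show ?thesis by (simp add: gdist_def)
qed

lemma shortest_path_exists: "\<exists>p. is_shortest_path E u p v"
proof -
  obtain p where "is_path E u p v"
    using connected by (auto simp: connected_graph_def)
  then have "\<exists>k p. is_path E u p v \<and> length p - 1 = k" by blast
  then show ?thesis
    unfolding is_shortest_path_def gdist_def by (rule LeastI_ex)
qed

lemma gdist_le: "is_path E u p v \<Longrightarrow> gdist E u v \<le> length p - 1"
  unfolding gdist_def by (rule Least_le) blast

lemma gdist_self: "gdist E u u = 0"
  using gdist_le[of u "[u]" u] by (simp add: is_path_def)

lemma gdist_pos:
  assumes "u \<noteq> v"
  shows "gdist E u v > 0"
proof -
  obtain p where p: "is_path E u p v" "length p - 1 = gdist E u v"
    using shortest_path_exists by (auto simp: is_shortest_path_def)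
  with assms show ?thesis by (cases p; cases "tl p") (auto simp: is_path_def)
qed

text \<open>Adjacent vertices are at distance 1, so the maximum in \<open>gain_max\<close> over an
  edge ranges over a single gain.\<close>

lemma shortest_path_edge_iff:
  assumes "E u v"
  shows "is_shortest_path E u p v \<longleftrightarrow> p = [u, v]"
proof -
  have "u \<noteq> v" using assms edge_irrefl by auto
  then have path: "is_path E u [u, v] v"
    using assms by (simp add: is_path_def)
  with gdist_le[of u "[u, v]" v] gdist_pos[OF \<open>u \<noteq> v\<close>] have d: "gdist E u v = 1" by simp
  show ?thesis
  proof
    assume "is_shortest_path E u p v"
    then have "length p = 2" "hd p = u" "last p = v"
      using d by (auto simp: is_shortest_path_def is_path_def)
    then show "p = [u, v]"
      by (auto simp: numeral_2_eq_2 length_Suc_conv)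
  qed (use path d in \<open>simp add: is_shortest_path_def\<close>)
qed

section \<open>Maximal gains of shortest paths\<close>

abbreviation shortest_gains :: "'v \<Rightarrow> 'v \<Rightarrow> complex set" where
  "shortest_gains s t \<equiv> {path_gain \<phi> p | p. is_shortest_path E s p t}"

lemma lex_Max_shortest_gains: "lex_Max (shortest_gains s t) \<in> shortest_gains s t"
proof -
  \<comment> \<open>Paths are distinct lists over a finite type, so there are finitely many.\<close>
  have "finite {p. is_shortest_path E s p t}"
    by (rule finite_subset[OF _ finite_subset_distinct[of "UNIV :: 'v set"]])
      (auto simp: is_shortest_path_def is_path_def)
  then have "finite (shortest_gains s t)" by simp
  moreover have "shortest_gains s t \<noteq> {}"
    using shortest_path_exists by auto
  ultimately show ?thesis using lex_Max_greatest by blast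
qed

text \<open>The maximum is attained. When it is taken from \<open>t\<close> to \<open>s\<close>,
  reversing the maximal path accounts for the conjugate.\<close>

lemma gain_max_is_path_gain:
  assumes "s \<noteq> t"
  obtains p where "is_shortest_path E s p t" "gain_max E \<phi> r s t = path_gain \<phi> p"
proof (cases "(s, t) \<in> r")
  case True
  with assms lex_Max_shortest_gains[of s t] that show ?thesis
    by (auto simp: gain_max_def)
next
  case False
  obtain p where p: "is_shortest_path E t p s" "lex_Max (shortest_gains t s) = path_gain \<phi> p"
    using lex_Max_shortest_gains[of t s] by auto
  from p(1) have "is_shortest_path E s (rev p) t"
    by (simp add: is_shortest_path_def is_path_rev gdist_commute)
  moreover from p(1) have "path_gain \<phi> (rev p) = cnj (path_gain \<phi> p)"
    by (simp add: is_shortest_path_def is_path_def path_gain_rev)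
  ultimately show ?thesis
    using that[of "rev p"] p False assms by (simp add: gain_max_def)
qed

lemma norm_gain_max: "s \<noteq> t \<Longrightarrow> norm (gain_max E \<phi> r s t) = 1"
  by (metis gain_max_is_path_gain is_path_def is_shortest_path_def norm_path_gain)

lemma gain_max_edge:
  assumes "E u v"
  shows "gain_max E \<phi> r u v = \<phi> u v"
proof -
  have "u \<noteq> v" using assms edge_irrefl by auto
  then show ?thesis
    by (rule gain_max_is_path_gain) (simp add: shortest_path_edge_iff[OF assms])
qed

section \<open>Quadratic form and kernel of the distance Laplacian\<close>

lemma laplacian_mult_vec:
  "(dist_laplacian_max E \<phi> r *v x) $ i =
    (\<Sum>j\<in>UNIV. of_nat (gdist E i j) * (x $ i - gain_max E \<phi> r i j * x $ j))"
proof -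
  have "(dist_laplacian_max E \<phi> r *v x) $ i =
      (\<Sum>j\<in>UNIV. (if i = j then of_nat (transmission E i) * x $ j else 0)
        - gain_max E \<phi> r i j * of_nat (gdist E i j) * x $ j)"
    unfolding matrix_vector_mult_def dist_laplacian_max_def transmission_matrix_def dist_matrix_max_def
    by (auto simp: left_diff_distrib intro!: sum.cong)
  \<comment> \<open>The diagonal entry is a row sum of distances, so its contribution can be spread
    over all \<open>j\<close>.\<close>
  also have "\<dots> = (\<Sum>j\<in>UNIV. of_nat (gdist E i j) * x $ i)
      - (\<Sum>j\<in>UNIV. gain_max E \<phi> r i j * of_nat (gdist E i j) * x $ j)"
    by (simp add: sum_subtractf transmission_def sum_distrib_right)
  finally show ?thesis
    by (simp add: sum_subtractf algebra_simps)
qed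

lemma laplacian_quadratic_form:
  fixes x :: "complex^'v"
  shows "(\<Sum>i\<in>UNIV. \<Sum>j\<in>UNIV. real (gdist E i j) * (norm (x $ i - gain_max E \<phi> r i j * x $ j))\<^sup>2) =
    2 * Re (\<Sum>i\<in>UNIV. cnj (x $ i) * (dist_laplacian_max E \<phi> r *v x) $ i)"
proof -
  let ?g = "gain_max E \<phi> r"
  let ?R = "\<lambda>i j. real (gdist E i j) * (norm (x $ i))\<^sup>2"
  let ?C = "\<lambda>i j. real (gdist E i j) * Re (cnj (x $ i) * (?g i j * x $ j))"
  have norm_diff: "(norm (a - b))\<^sup>2 = (norm a)\<^sup>2 + (norm b)\<^sup>2 - 2 * Re (cnj a * b)" for a b :: complex
    unfolding cmod_power2 by (simp add: power2_eq_square algebra_simps)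
  have summand: "real (gdist E i j) * (norm (x $ i - ?g i j * x $ j))\<^sup>2 = ?R i j + ?R j i - 2 * ?C i j" for i j
  \<comment> \<open>On the diagonal \<open>gain_max\<close> is 0 instead of unimodular, but there
    the distance 0 makes both sides vanish.\<close>
  proof (cases "i = j")
    case False
    then have "norm (?g i j * x $ j) = norm (x $ j)"
      by (simp add: norm_mult norm_gain_max)
    then show ?thesis
      by (simp only: norm_diff gdist_commute[of j i])
        (simp only: right_diff_distrib distrib_left mult.left_commute)
  qed (simp add: gdist_self)
  have Re_mult_diff: "Re (cnj a * (of_nat d * (a - b))) = real d * (norm a)\<^sup>2 - real d * Re (cnj a * b)"
    for a b :: complex and d
    unfolding cmod_power2 by (simp add: power2_eq_square algebra_simps)
  have "Re (\<Sum>i\<in>UNIV. cnj (x $ i) * (dist_laplacian_max E \<phi> r *v x) $ i) =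
      (\<Sum>i\<in>UNIV. \<Sum>j\<in>UNIV. ?R i j - ?C i j)"
    by (simp only: laplacian_mult_vec sum_distrib_left Re_sum Re_mult_diff)
  \<comment> \<open>Both squared terms have the same total, hence the factor 2.\<close>
  moreover have "(\<Sum>i\<in>UNIV. \<Sum>j\<in>UNIV. ?R j i) = (\<Sum>i\<in>UNIV. \<Sum>j\<in>UNIV. ?R i j)"
    by (rule sum.swap)
  ultimately show ?thesis
    by (simp only: summand sum.distrib sum_subtractf right_diff_distrib mult_2)
qed

text \<open>The quadratic form is a sum of nonnegative terms with positive weights off the diagonal,
  so every square vanishes. Conversely, each row of the product vanishes term by term.\<close>

lemma laplacian_kernel_iff:
  "dist_laplacian_max E \<phi> r *v x = 0 \<longleftrightarrow> (\<forall>i j. i \<noteq> j \<longrightarrow> x $ i = gain_max E \<phi> r i j * x $ j)"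
proof
  assume "dist_laplacian_max E \<phi> r *v x = 0"
  then have "(\<Sum>i\<in>UNIV. \<Sum>j\<in>UNIV.
      real (gdist E i j) * (norm (x $ i - gain_max E \<phi> r i j * x $ j))\<^sup>2) = 0"
    by (simp add: laplacian_quadratic_form)
  then have "real (gdist E i j) * (norm (x $ i - gain_max E \<phi> r i j * x $ j))\<^sup>2 = 0" for i j
    by (simp add: sum_nonneg_eq_0_iff sum_nonneg)
  then show "\<forall>i j. i \<noteq> j \<longrightarrow> x $ i = gain_max E \<phi> r i j * x $ j"
    using gdist_pos by (metis eq_iff_diff_eq_0 less_irrefl mult_eq_0_iff norm_eq_zero of_nat_eq_0_iff
        power_eq_0_iff)
next
  assume "\<forall>i j. i \<noteq> j \<longrightarrow> x $ i = gain_max E \<phi> r i j * x $ j"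
  then have "of_nat (gdist E i j) * (x $ i - gain_max E \<phi> r i j * x $ j) = 0" for i j
    by (cases "i = j") (auto simp: gdist_self)
  then show "dist_laplacian_max E \<phi> r *v x = 0"
    by (simp only: vec_eq_iff laplacian_mult_vec sum.neutral_const zero_index simp_thms)
qed

text \<open>Up to scaling, a nonzero potential is a switching function that turns all edge gains
  into 1.\<close>

definition potential :: "complex^'v \<Rightarrow> bool" where
  "potential x \<longleftrightarrow> (\<forall>u v. E u v \<longrightarrow> x $ u = \<phi> u v * x $ v)"

lemma potential_walk:
  assumes "potential x" "is_walk E u p v"
  shows "x $ u = path_gain \<phi> p * x $ v"
  using assms(2)
proof (induction p arbitrary: u rule: induct_list012)
  case (3 a b zs)
  then have "x $ b = path_gain \<phi> (b # zs) * x $ v" "E a b" "u = a"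
    by (auto simp: is_walk_def)
  with assms(1) show ?case by (simp add: potential_def)
qed (auto simp: is_walk_def)

text \<open>One inclusion reads the kernel equations on edges only; the other multiplies the edge
  relations along a shortest path of maximal gain.\<close>

lemma laplacian_kernel_eq_potentials:
  "{x. dist_laplacian_max E \<phi> r *v x = 0} = {x. potential x}"
proof (intro Collect_cong iffI)
  fix x assume "dist_laplacian_max E \<phi> r *v x = 0"
  then show "potential x"
    by (metis edge_irrefl gain_max_edge laplacian_kernel_iff potential_def)
next
  fix x assume "potential x"
  then have "x $ i = gain_max E \<phi> r i j * x $ j" if "i \<noteq> j" for i j
    by (metis gain_max_is_path_gain is_path_imp_is_walk is_shortest_path_def potential_walk that)
  then show "dist_laplacian_max E \<phi> r *v x = 0"
    by (simp add: laplacian_kernel_iff)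
qed

lemma walk_exists: "\<exists>p. is_walk E u p v"
  using connected is_path_imp_is_walk by (fastforce simp: connected_graph_def)

text \<open>A zero at \<open>v\<close> would spread to every vertex along the walks to
  \<open>v\<close>.\<close>

lemma potential_nonzero:
  assumes "potential x" "x \<noteq> 0"
  shows "x $ v \<noteq> 0"
proof -
  obtain u where "x $ u \<noteq> 0" using assms(2) by (auto simp: vec_eq_iff)
  moreover obtain p where "is_walk E u p v" using walk_exists by blast
  ultimately show ?thesis using potential_walk[OF assms(1)] by auto
qed

text \<open>Going once round a cycle multiplies a nonzero entry by the cycle gain and gives the same
  entry back.\<close>

lemma potential_imp_balanced:
  assumes "potential x" "x \<noteq> 0"
  shows "balanced E \<phi>"
  unfolding balanced_def
proof (intro allI impI)
  fix p assume "is_cycle E p"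
  then have "is_walk E (hd p) (p @ [hd p]) (hd p)"
    by (auto simp: is_cycle_def is_walk_def successively_append_iff hd_append)
  from potential_walk[OF assms(1) this] show "cycle_gain \<phi> p = 1"
    using potential_nonzero[OF assms, of "hd p"] by (simp add: cycle_gain_def)
qed

section \<open>Balance and path independence\<close>

text \<open>A closed walk that repeats an inner vertex is cut there into two shorter closed walks.\<close>

lemma balanced_closed_walk:
  assumes "balanced E \<phi>" "is_walk E u p u"
  shows "path_gain \<phi> p = 1"
  using assms(2)
proof (induction p arbitrary: u rule: length_induct)
  case (1 p)
  \<comment> \<open>Without the final \<open>u\<close>, the list has the form used by
    \<open>is_cycle\<close>, whose closing edge is implicit.\<close>
  define q where "q = butlast p"
  have p: "p = q @ [u]"
    using "1.prems" append_butlast_last_id[of p] by (simp add: q_def is_walk_def)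
  show ?case
  proof (cases "distinct q")
    case True
    have hd: "q \<noteq> [] \<Longrightarrow> hd q = u" "successively E q" "q \<noteq> [] \<Longrightarrow> E (last q) u"
      using "1.prems" unfolding p is_walk_def by (auto simp: successively_append_iff)
    show ?thesis
    \<comment> \<open>Too short for \<open>is_cycle\<close>: \<open>q\<close> is empty, or would
      give a loop, or runs along one edge and back, with gain 1.\<close>
    proof (cases "length q < 3")
      case True
      then consider "q = []" | a where "q = [a]" | a b where "q = [a, b]"
        by (cases q rule: remdups_adj.cases) auto
      then show ?thesis
      proof cases
        case 2
        with hd edge_irrefl show ?thesis by simp
      next
        case 3
        with hd have "a = u" "E u b" by simp_all
        with 3 show ?thesis by (simp add: p edge_gain_mult_flip)
      qed (simp add: p)
    next
      case False
      then have "q \<noteq> []" by auto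
      with False have "is_cycle E q"
        using hd \<open>distinct q\<close> by (simp add: is_cycle_def)
      with assms(1) have "cycle_gain \<phi> q = 1" by (simp add: balanced_def)
      with hd \<open>q \<noteq> []\<close> show ?thesis by (simp add: cycle_gain_def p)
    qed
  next
    case False
    then obtain a x b c where q: "q = a @ [x] @ b @ [x] @ c"
      using not_distinct_decomp[of q] by auto
    have walks: "is_walk E u (a @ [x]) x" "is_walk E x (x # b @ [x]) x" "is_walk E x (x # c @ [u]) u"
      using "1.prems" is_walk_append[of E u a x "b @ x # c @ [u]" u]
        is_walk_append[of E x "x # b" x "c @ [u]" u]
      by (simp_all add: p q)
    then have "is_walk E u (a @ x # c @ [u]) u"
      by (subst is_walk_append) simp
    then have "path_gain \<phi> (a @ x # c @ [u]) = 1"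
      by (intro "1.IH"[rule_format, of _ u]) (simp_all add: p q)
    moreover have "path_gain \<phi> (x # b @ [x]) = 1"
      using walks(2) by (intro "1.IH"[rule_format, of _ x]) (simp_all add: p q)
    ultimately show ?thesis
      using path_gain_append[of \<phi> a x "b @ x # c @ [u]"] path_gain_append[of \<phi> a x "c @ [u]"]
        path_gain_append[of \<phi> "x # b" x "c @ [u]"]
      by (simp add: p q)
  qed
qed

text \<open>Following \<open>p\<close> and returning along \<open>rev q\<close> is a closed walk,
  and the way back contributes the conjugate, hence inverse, gain of \<open>q\<close>.\<close>

lemma balanced_walks_eq_gain:
  assumes "balanced E \<phi>" "is_walk E u p v" "is_walk E u q v"
  shows "path_gain \<phi> p = path_gain \<phi> q"
proof -
  obtain p' where p': "p = p' @ [v]"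
    using assms(2) by (metis append_butlast_last_id is_walk_def)
  obtain q' where q': "rev q = v # q'"
    using is_walk_rev[OF assms(3)] by (cases "rev q") (auto simp: is_walk_def)
  have "is_walk E u (p' @ v # q') u"
    using assms(2) is_walk_rev[OF assms(3)] by (subst is_walk_append) (simp add: p' q')
  then have "path_gain \<phi> p * path_gain \<phi> (rev q) = 1"
    using balanced_closed_walk[OF assms(1)] path_gain_append[of \<phi> p' v q'] by (simp add: p' q')
  moreover have q: "successively E q" using assms(3) by (simp add: is_walk_def)
  ultimately have "path_gain \<phi> p * cnj (path_gain \<phi> q) = path_gain \<phi> q * cnj (path_gain \<phi> q)"
    by (simp add: path_gain_rev norm_path_gain flip: complex_norm_square)
  with norm_path_gain[OF q] show ?thesis by auto
qed

lemma balanced_imp_potential: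
  assumes "balanced E \<phi>"
  shows "\<exists>x. potential x \<and> x \<noteq> 0"
proof -
  fix root :: 'v
  define P where "P v = (SOME p. is_walk E v p root)" for v
  have P: "is_walk E v (P v) root" for v
    unfolding P_def by (rule someI_ex) (rule walk_exists)
  define x :: "complex^'v" where "x = (\<chi> v. path_gain \<phi> (P v))"
  have "x $ u = \<phi> u v * x $ v" if "E u v" for u v
  proof -
    obtain p where p: "P v = v # p"
      using P[of v] by (cases "P v") (auto simp: is_walk_def)
    \<comment> \<open>The walk chosen for \<open>u\<close> may avoid \<open>v\<close>, but by
      balance it has the same gain as the edge to \<open>v\<close> followed by
      \<open>P v\<close>.\<close>
    with P[of v] that have "is_walk E u (u # P v) root"
      by (auto simp: is_walk_def)
    from balanced_walks_eq_gain[OF assms P this] show ?thesis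
      by (simp add: x_def p)
  qed
  moreover have "norm (x $ root) = 1"
    using P[of root] by (simp add: x_def norm_path_gain is_walk_def)
  ultimately show ?thesis
    unfolding potential_def by (metis norm_zero zero_index zero_neq_one)
qed

section \<open>Dimension of the space of potentials\<close>

lemma potentials_eq_span:
  assumes "potential x" "x \<noteq> 0"
  shows "{y. potential y} = vec.span {x}"
proof (intro set_eqI iffI; clarsimp simp: vec.span_singleton)
  fix y assume y: "potential y"
  fix root :: 'v
  \<comment> \<open>One walk to \<open>root\<close> relates both potentials to their root values by
    the same gain, so their ratio is constant.\<close>
  have "y $ u = (y $ root / x $ root) * x $ u" for u
  proof -
    obtain p where p: "is_walk E u p root" using walk_exists by blast
    show ?thesis
      using potential_walk[OF y p] potential_walk[OF assms(1) p] potential_nonzero[OF assms, of root]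
      by simp
  qed
  then have "y = (y $ root / x $ root) *s x"
    unfolding vec_eq_iff vector_smult_component by (intro allI)
  then show "y \<in> range (\<lambda>k. k *s x)" by blast
next
  fix k show "potential (k *s x)"
    using assms(1) by (simp add: potential_def)
qed

lemma nullity_laplacian:
  "nullity (dist_laplacian_max E \<phi> r) = (if balanced E \<phi> then 1 else 0)"
proof (cases "balanced E \<phi>")
  case True
  then obtain x where x: "potential x" "x \<noteq> 0"
    using balanced_imp_potential by blast
  have "vec.independent {x}" using x(2) by simp
  then have "vec.dim {x} = 1" by (simp add: vec.dim_eq_card_independent)
  then show ?thesis
    using True by (simp add: nullity_def laplacian_kernel_eq_potentials potentials_eq_span[OF x])
next
  case False
  then have "{x. potential x} \<subseteq> {0}"
    using potential_imp_balanced by blast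
  then show ?thesis
    using False by (simp add: nullity_def laplacian_kernel_eq_potentials)
qed

end

theorem theorem3p6:
  fixes E :: "'v::finite \<Rightarrow> 'v \<Rightarrow> bool"
    and \<phi> :: "'v \<Rightarrow> 'v \<Rightarrow> complex"
    and r :: "'v rel"
  assumes "simple_graph E"
    and "connected_graph E"
    and "gain_function E \<phi>"
    and "strict_linear_order r"
  shows "(nullity (dist_laplacian_max E \<phi> r) = 1 \<longleftrightarrow> balanced E \<phi>) \<and>
         (nullity (dist_laplacian_max E \<phi> r) = 0 \<longleftrightarrow> \<not> balanced E \<phi>)"
proof -
  interpret gain_graph E \<phi>
    by (rule gain_graph.intro) (fact assms)+
  show ?thesis by (simp add: nullity_laplacian)
qed

end
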